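(* Let $L$ be a sectionally complemented modular lattice. Then the dimension map $\Delta\colon L\to\operatorname{Dim}L$, $x\mapsto\Delta(x)$, is a V-measure, that is, if $c\in L$ and $\alpha,\beta\in\operatorname{Dim}L$ are such that $\Delta(c)=\alpha+\beta$, then there exist $a,b\in L$ such that $\alpha=\Delta(a)$, $\beta=\Delta(b)$, and $c=a\oplus b$. In particular, the dimension range of $L$, that is, $\{\Delta(x)\mid x\in L\}$, is a lower subset of $\operatorname{Dim}L$ (with respect to the algebraic preordering).
   Context: For a lattice $L$, the dimension monoid $\operatorname{Dim}L$ is the commutative monoid defined by generators $\Delta(a,b)$ (for $a\leq b$ in $L$) and the relations: (D0) $\Delta(a,a)=0$ for all $a\in L$; (D1) $\Delta(a,c)=\Delta(a,b)+\Delta(b,c)$ for all $a\leq b\leq c$ in $L$; (D2) $\Delta(a,a\vee b)=\Delta(a\wedge b,b)$ for all $a,b\in L$. If $L$ has a least element $0$, write $\Delta(x)=\Delta(0,x)$. A lattice is sectionally complemented if it has a least element $0$ and every interval $[0,a]$ is complemented. In a lattice with zero, $c=a\oplus b$ means $a\wedge b=0$ and $a\vee b=c$. The algebraic preordering of a commutative monoid is $x\leq y$ iff $x+z=y$ for some $z$; a lower subset is a subset $X$ such that $x\in X$ and $p\leq x$ imply $p\in X$. *)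

theory Defs
  imports "HOL-Library.Multiset" "HOL-Library.Interval"
begin

class modular_lattice = lattice +
  assumes modular_law: "x \<le> z \<Longrightarrow> sup x (inf y z) = inf (sup x y) z"

class sectionally_complemented_lattice = bounded_lattice_bot +
  assumes section_complement: "x \<le> a \<Longrightarrow> \<exists>y\<le>a. inf x y = bot \<and> sup x y = a"

text \<open>
  Multisets of intervals form the free commutative monoid on the pairs \<open>(a, b)\<close> with
  \<open>a \<le> b\<close>. The following relation is the monoid congruence on it generated by the
  relations (D0), (D1), (D2). The value of \<open>Interval (a, b)\<close> is unspecified unless
  \<open>a \<le> b\<close>; all pairs occurring below satisfy this condition.
\<close>

inductive dim_cong :: "'a::lattice interval multiset \<Rightarrow> 'a interval multiset \<Rightarrow> bool" where
  D0: "dim_cong {#Interval (a, a)#} {#}"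
| D1: "a \<le> b \<Longrightarrow> b \<le> c \<Longrightarrow>
    dim_cong {#Interval (a, c)#} {#Interval (a, b), Interval (b, c)#}"
| D2: "dim_cong {#Interval (a, sup a b)#} {#Interval (inf a b, b)#}"
| refl: "dim_cong M M"
| sym: "dim_cong M N \<Longrightarrow> dim_cong N M"
| trans: "dim_cong M N \<Longrightarrow> dim_cong N P \<Longrightarrow> dim_cong M P"
| add: "dim_cong M N \<Longrightarrow> dim_cong M' N' \<Longrightarrow> dim_cong (M + M') (N + N')"

quotient_type (overloaded) 'a dim_monoid = "'a::lattice interval multiset" / dim_cong
  by (rule equivpI; rule reflpI sympI transpI)
    (blast intro: dim_cong.refl dim_cong.sym dim_cong.trans)+

instantiation dim_monoid :: (lattice) comm_monoid_add
begin

lift_definition zero_dim_monoid :: "'a dim_monoid" is "{#}" .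

lift_definition plus_dim_monoid :: "'a dim_monoid \<Rightarrow> 'a dim_monoid \<Rightarrow> 'a dim_monoid"
  is "(+)"
  by (rule dim_cong.add)

instance
  by standard (transfer; simp add: ac_simps dim_cong.refl)+

end

lift_definition Delta_interval :: "'a::lattice interval \<Rightarrow> 'a dim_monoid" is "\<lambda>i. {#i#}" .

definition Delta :: "'a::bounded_lattice_bot \<Rightarrow> 'a dim_monoid" where
  "Delta x = Delta_interval (Interval (bot, x))"

text \<open>\<open>is_oplus c a b\<close> stands for \<open>c = a \<oplus> b\<close>.\<close>

definition is_oplus :: "'a::bounded_lattice_bot \<Rightarrow> 'a \<Rightarrow> 'a \<Rightarrow> bool" where
  "is_oplus c a b \<longleftrightarrow> inf a b = bot \<and> sup a b = c"

definition V_measure :: "('a::bounded_lattice_bot \<Rightarrow> 'm::comm_monoid_add) \<Rightarrow> bool" where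
  "V_measure \<mu> \<longleftrightarrow> (\<forall>c \<alpha> \<beta>. \<mu> c = \<alpha> + \<beta> \<longrightarrow>
     (\<exists>a b. \<alpha> = \<mu> a \<and> \<beta> = \<mu> b \<and> is_oplus c a b))"

definition alg_le :: "'m::comm_monoid_add \<Rightarrow> 'm \<Rightarrow> bool" where
  "alg_le x y \<longleftrightarrow> (\<exists>z. x + z = y)"

definition lower_subset :: "'m::comm_monoid_add set \<Rightarrow> bool" where
  "lower_subset X \<longleftrightarrow> (\<forall>x p. x \<in> X \<longrightarrow> alg_le p x \<longrightarrow> p \<in> X)"

end

theory Submission
  imports Defs "HOL-Library.Product_Plus"
begin

text \<open>
  Suppose that \<open>\<Delta>(c) = \<alpha> + \<beta>\<close>. It suffices to find a chain \<open>0 = x\<^sub>0 \<le> x\<^sub>1 \<le> \<dots> \<le> x\<^sub>n = c\<close> and a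
  colouring of its steps by two colours such that the steps of the first colour have the sum
  \<open>\<Delta>(x\<^sub>i, x\<^sub>i\<^sub>+\<^sub>1)\<close> equal to \<open>\<alpha>\<close>, and those of the second colour have the sum \<open>\<beta>\<close>. Indeed, a
  sectional complement \<open>d\<^sub>i\<close> of each \<open>x\<^sub>i\<close> in \<open>x\<^sub>i\<^sub>+\<^sub>1\<close> satisfies \<open>\<Delta>(d\<^sub>i) = \<Delta>(x\<^sub>i, x\<^sub>i\<^sub>+\<^sub>1)\<close>, the element
  \<open>c\<close> is the direct sum of all \<open>d\<^sub>i\<close> by modularity, and one groups the \<open>d\<^sub>i\<close> by colour
  (\<open>coloured_chain_imp_oplus\<close>).

  The chain comes from an invariant of the defining congruence of the dimension monoid. Let
  \<open>splittings a b\<close> be the set of all pairs \<open>(\<alpha>, \<beta>)\<close> that arise from a two-coloured chain from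
  \<open>a\<close> to \<open>b\<close>, and extend this assignment additively, with respect to the sum of sets, to formal
  sums of intervals. The extension identifies the two sides of (D0), (D1) and (D2) in every modular
  lattice, hence it is constant on congruence classes (\<open>dim_cong_imp_splittings_mset_eq\<close>). All three
  cases rest on one fact: the maps \<open>x \<mapsto> x \<and> b\<close> and \<open>x \<mapsto> x \<or> b\<close> turn a chain into two chains,
  and the \<open>\<Delta>\<close> of each step is the sum of the \<open>\<Delta>\<close> of its two images (\<open>dim_cut\<close>), so that a
  colouring is inherited by both images with the same totals. Now take formal sums \<open>A\<close>
  and \<open>B\<close> of intervals that represent \<open>\<alpha>\<close> and \<open>\<beta>\<close>. Giving the first colour to \<open>A\<close> and the second one to
  \<open>B\<close> shows that \<open>(\<alpha>, \<beta>)\<close> is a splitting of \<open>A + B\<close>. Since \<open>A + B\<close> is congruent to the single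
  interval \<open>[0, c]\<close>, the pair is also a splitting of \<open>[0, c]\<close>, which is the chain that was sought.
\<close>

section \<open>Arithmetic of the dimension monoid\<close>

abbreviation dim :: "'a::lattice \<Rightarrow> 'a \<Rightarrow> 'a dim_monoid" where
  "dim a b \<equiv> Delta_interval (Interval (a, b))"

lemma dim_self: "dim a a = 0"
  by transfer (rule dim_cong.D0)

lemma dim_add:
  assumes "a \<le> b" "b \<le> c"
  shows "dim a b + dim b c = dim a c"
proof -
  have "dim_cong {#Interval (a, c)#} ({#Interval (a, b)#} + {#Interval (b, c)#})"
    using dim_cong.D1[OF assms] by (simp add: add_mset_commute)
  then show ?thesis
    by (metis Delta_interval.abs_eq dim_monoid.abs_eq_iff plus_dim_monoid.abs_eq)
qed

lemma dim_sup_eq_dim_inf: "dim a (sup a b) = dim (inf a b) b"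
  by transfer (rule dim_cong.D2)

text \<open>
  The element \<open>m = x \<or> (y \<and> b) = (x \<or> b) \<and> y\<close> between \<open>x\<close> and \<open>y\<close> cuts \<open>[x, y]\<close> into a part
  that is transposed to \<open>[x \<and> b, y \<and> b]\<close> and a part that is transposed to \<open>[x \<or> b, y \<or> b]\<close>.
\<close>

lemma dim_cut:
  fixes x y b :: "'a::modular_lattice"
  assumes "x \<le> y"
  shows "dim x y = dim (inf x b) (inf y b) + dim (sup x b) (sup y b)"
proof -
  define m where "m = sup x (inf y b)"
  have m: "m = inf (sup x b) y"
    using modular_law[OF assms, of b] by (simp add: m_def inf_commute)
  have "dim x m = dim (inf x (inf y b)) (inf y b)"
    unfolding m_def by (rule dim_sup_eq_dim_inf)
  also have "inf x (inf y b) = inf x b"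
    using assms by (simp add: inf_assoc[symmetric] inf_absorb1)
  finally have lower_part: "dim x m = dim (inf x b) (inf y b)" .
  have "dim m y = dim (sup x b) (sup (sup x b) y)"
    unfolding m by (rule dim_sup_eq_dim_inf[symmetric])
  also have "sup (sup x b) y = sup y b"
    using assms by (metis sup_absorb2 sup_commute sup_left_commute)
  finally have upper_part: "dim m y = dim (sup x b) (sup y b)" .
  have "x \<le> m" "m \<le> y"
    by (simp add: m_def) (simp add: m)
  then show ?thesis
    using dim_add lower_part upper_part by metis
qed

section \<open>Two-coloured chains\<close>

inductive coloured_chain ::
  "'a::lattice \<Rightarrow> 'a \<Rightarrow> 'a dim_monoid \<Rightarrow> 'a dim_monoid \<Rightarrow> bool" for a where
  start: "coloured_chain a a 0 0"
| left_step: "coloured_chain a x \<alpha> \<beta> \<Longrightarrow> x \<le> y \<Longrightarrow> coloured_chain a y (\<alpha> + dim x y) \<beta>"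
| right_step: "coloured_chain a x \<alpha> \<beta> \<Longrightarrow> x \<le> y \<Longrightarrow> coloured_chain a y \<alpha> (\<beta> + dim x y)"

lemma coloured_chain_le: "coloured_chain a b \<alpha> \<beta> \<Longrightarrow> a \<le> b"
  by (induction rule: coloured_chain.induct) auto

lemma coloured_chain_self:
  assumes "coloured_chain a a \<alpha> \<beta>"
  shows "\<alpha> = 0 \<and> \<beta> = 0"
proof -
  have "b \<le> a \<Longrightarrow> \<alpha> = 0 \<and> \<beta> = 0" if "coloured_chain a b \<alpha> \<beta>" for b
    using that
  proof (induction rule: coloured_chain.induct)
    case (left_step x \<alpha> \<beta> y)
    then have "x = a" "y = a"
      using coloured_chain_le by (meson order.antisym order.trans)+
    with left_step show ?case by (simp add: dim_self)
  next
    case (right_step x \<alpha> \<beta> y)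
    then have "x = a" "y = a"
      using coloured_chain_le by (meson order.antisym order.trans)+
    with right_step show ?case by (simp add: dim_self)
  qed simp
  with assms show ?thesis by blast
qed

lemma coloured_chain_append:
  assumes "coloured_chain a b \<alpha> \<beta>" "coloured_chain b c \<alpha>' \<beta>'"
  shows "coloured_chain a c (\<alpha> + \<alpha>') (\<beta> + \<beta>')"
  using assms(2,1)
  by (induction rule: coloured_chain.induct)
    (auto simp: add.assoc[symmetric] intro: coloured_chain.intros)

definition splittings :: "'a::lattice \<Rightarrow> 'a \<Rightarrow> ('a dim_monoid \<times> 'a dim_monoid) set" where
  "splittings a b = {(\<alpha>, \<beta>). coloured_chain a b \<alpha> \<beta>}"

lemma splittings_self: "splittings a a = 0"
  by (auto simp: splittings_def zero_prod_def intro: coloured_chain.start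
      dest: coloured_chain_self)

lemma splittings_append: "splittings a b + splittings b c \<subseteq> splittings a c"
  by (auto simp: splittings_def set_plus_def intro: coloured_chain_append)

text \<open>Both images of a chain inherit its colouring; \<open>dim_cut\<close> adds up the totals step by step.\<close>

lemma splittings_cut:
  fixes a b c :: "'a::modular_lattice"
  shows "splittings a c \<subseteq> splittings (inf a b) (inf c b) + splittings (sup a b) (sup c b)"
proof -
  have "\<exists>\<alpha>\<^sub>1 \<alpha>\<^sub>2 \<beta>\<^sub>1 \<beta>\<^sub>2. \<alpha> = \<alpha>\<^sub>1 + \<alpha>\<^sub>2 \<and> \<beta> = \<beta>\<^sub>1 + \<beta>\<^sub>2 \<and>
      coloured_chain (inf a b) (inf c b) \<alpha>\<^sub>1 \<beta>\<^sub>1 \<and> coloured_chain (sup a b) (sup c b) \<alpha>\<^sub>2 \<beta>\<^sub>2"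
    if "coloured_chain a c \<alpha> \<beta>" for \<alpha> \<beta>
    using that
  proof (induction rule: coloured_chain.induct)
    case start
    show ?case
      using coloured_chain.start by (metis add_0)
  next
    case (left_step x \<alpha> \<beta> y)
    then obtain \<alpha>\<^sub>1 \<alpha>\<^sub>2 \<beta>\<^sub>1 \<beta>\<^sub>2 where IH: "\<alpha> = \<alpha>\<^sub>1 + \<alpha>\<^sub>2" "\<beta> = \<beta>\<^sub>1 + \<beta>\<^sub>2"
        "coloured_chain (inf a b) (inf x b) \<alpha>\<^sub>1 \<beta>\<^sub>1" "coloured_chain (sup a b) (sup x b) \<alpha>\<^sub>2 \<beta>\<^sub>2"
      by blast
    have "\<alpha> + dim x y
        = (\<alpha>\<^sub>1 + dim (inf x b) (inf y b)) + (\<alpha>\<^sub>2 + dim (sup x b) (sup y b))"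
      using dim_cut[OF left_step.hyps(2), of b] IH(1) by (simp add: ac_simps)
    moreover have "coloured_chain (inf a b) (inf y b) (\<alpha>\<^sub>1 + dim (inf x b) (inf y b)) \<beta>\<^sub>1"
      using IH(3) left_step.hyps(2) by (intro coloured_chain.left_step inf_mono) auto
    moreover have "coloured_chain (sup a b) (sup y b) (\<alpha>\<^sub>2 + dim (sup x b) (sup y b)) \<beta>\<^sub>2"
      using IH(4) left_step.hyps(2) by (intro coloured_chain.left_step sup_mono) auto
    ultimately show ?case using IH(2) by blast
  next
    case (right_step x \<alpha> \<beta> y)
    then obtain \<alpha>\<^sub>1 \<alpha>\<^sub>2 \<beta>\<^sub>1 \<beta>\<^sub>2 where IH: "\<alpha> = \<alpha>\<^sub>1 + \<alpha>\<^sub>2" "\<beta> = \<beta>\<^sub>1 + \<beta>\<^sub>2"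
        "coloured_chain (inf a b) (inf x b) \<alpha>\<^sub>1 \<beta>\<^sub>1" "coloured_chain (sup a b) (sup x b) \<alpha>\<^sub>2 \<beta>\<^sub>2"
      by blast
    have "\<beta> + dim x y
        = (\<beta>\<^sub>1 + dim (inf x b) (inf y b)) + (\<beta>\<^sub>2 + dim (sup x b) (sup y b))"
      using dim_cut[OF right_step.hyps(2), of b] IH(2) by (simp add: ac_simps)
    moreover have "coloured_chain (inf a b) (inf y b) \<alpha>\<^sub>1 (\<beta>\<^sub>1 + dim (inf x b) (inf y b))"
      using IH(3) right_step.hyps(2) by (intro coloured_chain.right_step inf_mono) auto
    moreover have "coloured_chain (sup a b) (sup y b) \<alpha>\<^sub>2 (\<beta>\<^sub>2 + dim (sup x b) (sup y b))"
      using IH(4) right_step.hyps(2) by (intro coloured_chain.right_step sup_mono) auto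
    ultimately show ?case using IH(1) by blast
  qed
  then show ?thesis
    by (fastforce simp: splittings_def set_plus_def)
qed

lemma splittings_add:
  fixes a b c :: "'a::modular_lattice"
  assumes "a \<le> b" "b \<le> c"
  shows "splittings a b + splittings b c = splittings a c"
  using splittings_append[of a b c] splittings_cut[of a c b] assms
  by (auto simp: inf_absorb1 inf_absorb2 sup_absorb1 sup_absorb2)

text \<open>
  Cutting \<open>[a, a \<or> b]\<close> along \<open>b\<close> leaves a trivial upper image, and cutting \<open>[a \<and> b, b]\<close> along \<open>a\<close>
  leaves a trivial lower image.
\<close>

lemma splittings_sup_eq_splittings_inf:
  fixes a b :: "'a::modular_lattice"
  shows "splittings a (sup a b) = splittings (inf a b) b"
proof
  have "splittings a (sup a b) \<subseteq> splittings (inf a b) b + splittings (sup a b) (sup a b)"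
    using splittings_cut[of a "sup a b" b] by (simp add: inf_absorb2 sup_assoc)
  then show "splittings a (sup a b) \<subseteq> splittings (inf a b) b"
    by (simp only: splittings_self add_0_right)
  have "splittings (inf a b) b \<subseteq> splittings (inf a b) (inf a b) + splittings a (sup a b)"
    using splittings_cut[of "inf a b" b a]
    by (simp add: inf_commute sup_commute inf_absorb1 inf_absorb2 sup_absorb2)
  then show "splittings (inf a b) b \<subseteq> splittings a (sup a b)"
    by (simp only: splittings_self add_0)
qed

section \<open>Splittings as an invariant of the dimension congruence\<close>

definition splittings_mset ::
  "'a::lattice interval multiset \<Rightarrow> ('a dim_monoid \<times> 'a dim_monoid) set" where
  "splittings_mset M = (\<Sum>i\<in>#M. splittings (lower i) (upper i))"

lemma splittings_mset_empty: "splittings_mset {#} = 0"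
  by (simp only: splittings_mset_def image_mset_empty sum_mset.empty)

lemma splittings_mset_union:
  "splittings_mset (M + N) = splittings_mset M + splittings_mset N"
  by (simp add: splittings_mset_def)

lemma splittings_mset_single:
  assumes "a \<le> b"
  shows "splittings_mset {#Interval (a, b)#} = splittings a b"
  using assms
  by (simp add: splittings_mset_def lower.rep_eq upper.rep_eq Interval_inverse)

lemma dim_cong_imp_splittings_mset_eq:
  fixes M N :: "'a::modular_lattice interval multiset"
  assumes "dim_cong M N"
  shows "splittings_mset M = splittings_mset N"
  using assms
proof (induction rule: dim_cong.induct)
  case (D0 a)
  show ?case
    by (simp only: splittings_mset_single[OF order.refl] splittings_self splittings_mset_empty)
next
  case (D1 a b c)
  have "splittings_mset {#Interval (a, b), Interval (b, c)#}
      = splittings_mset {#Interval (a, b)#} + splittings_mset {#Interval (b, c)#}"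
    by (simp flip: splittings_mset_union add: add_mset_commute)
  with D1 show ?case
    by (simp add: splittings_mset_single splittings_add order.trans[OF D1])
next
  case (D2 a b)
  show ?case
    by (simp add: splittings_mset_single splittings_sup_eq_splittings_inf)
qed (simp_all add: splittings_mset_union)

text \<open>These are the splittings that give one colour to all intervals of a formal sum.\<close>

lemma monochromatic_splittings:
  "(abs_dim_monoid M, 0) \<in> splittings_mset M" "(0, abs_dim_monoid M) \<in> splittings_mset M"
proof (induction M)
  case empty
  show "(abs_dim_monoid {#}, 0) \<in> splittings_mset {#}" "(0, abs_dim_monoid {#}) \<in> splittings_mset {#}"
    by (simp_all add: splittings_mset_empty zero_prod_def flip: zero_dim_monoid_def)
next
  case (add i M)
  have i: "dim (lower i) (upper i) = abs_dim_monoid {#i#}"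
    by (simp add: Delta_interval.abs_eq lower.rep_eq upper.rep_eq bounds_of_interval_inverse)
  have abs: "abs_dim_monoid (add_mset i M) = abs_dim_monoid {#i#} + abs_dim_monoid M"
    by (simp add: plus_dim_monoid.abs_eq)
  have split: "splittings_mset (add_mset i M) = splittings (lower i) (upper i) + splittings_mset M"
    by (simp add: splittings_mset_def)
  have "(abs_dim_monoid {#i#}, 0) \<in> splittings (lower i) (upper i)"
    using coloured_chain.left_step[OF coloured_chain.start lower_le_upper[of i]]
    by (simp add: splittings_def i)
  then have "(abs_dim_monoid {#i#}, 0) + (abs_dim_monoid M, 0) \<in> splittings_mset (add_mset i M)"
    unfolding split using add.IH(1) by (rule set_plus_intro)
  then show "(abs_dim_monoid (add_mset i M), 0) \<in> splittings_mset (add_mset i M)"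
    by (simp add: abs)
  have "(0, abs_dim_monoid {#i#}) \<in> splittings (lower i) (upper i)"
    using coloured_chain.right_step[OF coloured_chain.start lower_le_upper[of i]]
    by (simp add: splittings_def i)
  then have "(0, abs_dim_monoid {#i#}) + (0, abs_dim_monoid M) \<in> splittings_mset (add_mset i M)"
    unfolding split using add.IH(2) by (rule set_plus_intro)
  then show "(0, abs_dim_monoid (add_mset i M)) \<in> splittings_mset (add_mset i M)"
    by (simp add: abs)
qed

lemma dim_eq_add_imp_coloured_chain:
  fixes a b :: "'a::modular_lattice"
  assumes "a \<le> b" and "dim a b = \<alpha> + \<beta>"
  shows "coloured_chain a b \<alpha> \<beta>"
proof -
  obtain A B where AB: "\<alpha> = abs_dim_monoid A" "\<beta> = abs_dim_monoid B"
    by (metis Quotient_abs_rep Quotient_dim_monoid)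
  have "(\<alpha>, 0) + (0, \<beta>) \<in> splittings_mset A + splittings_mset B"
    unfolding AB by (intro set_plus_intro monochromatic_splittings)
  then have "(\<alpha>, \<beta>) \<in> splittings_mset (A + B)"
    by (simp add: splittings_mset_union)
  moreover have "dim_cong {#Interval (a, b)#} (A + B)"
    using assms(2) unfolding AB
    by (simp add: Delta_interval.abs_eq plus_dim_monoid.abs_eq dim_monoid.abs_eq_iff)
  ultimately have "(\<alpha>, \<beta>) \<in> splittings a b"
    using dim_cong_imp_splittings_mset_eq splittings_mset_single[OF assms(1)] by blast
  then show ?thesis by (simp add: splittings_def)
qed

section \<open>From coloured chains to direct sums\<close>

lemma Delta_oplus:
  assumes "is_oplus c a b"
  shows "Delta c = Delta a + Delta b"
proof -
  have "dim a c = dim bot b"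
    using assms dim_sup_eq_dim_inf[of a b] by (simp add: is_oplus_def)
  moreover have "a \<le> c"
    using assms by (auto simp: is_oplus_def)
  ultimately show ?thesis
    using dim_add[of bot a c] by (simp add: Delta_def)
qed

lemma is_oplus_commute: "is_oplus c a b \<longleftrightarrow> is_oplus c b a"
  by (simp add: is_oplus_def inf_commute sup_commute)

text \<open>
  This is associativity of the direct sum, where modularity is essential: the part of \<open>a \<or> d\<close>
  below \<open>a \<or> b\<close> is \<open>a \<or> (d \<and> (a \<or> b)) = a\<close>, so \<open>a \<or> d\<close> meets \<open>b\<close> only within \<open>a\<close>.
\<close>

lemma is_oplus_extend:
  fixes a b d x y :: "'a::{modular_lattice, bounded_lattice_bot}"
  assumes "is_oplus x a b" "is_oplus y x d"
  shows "is_oplus (sup a d) a d" "is_oplus y (sup a d) b"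
proof -
  have ab: "inf a b = bot" "sup a b = x" and xd: "inf x d = bot" "sup x d = y"
    using assms by (auto simp: is_oplus_def)
  have "inf a d \<le> inf x d"
    using ab by (intro inf_mono) auto
  then show "is_oplus (sup a d) a d"
    using xd by (simp add: is_oplus_def bot_unique)
  have "inf (sup a d) x = sup a (inf d x)"
    using modular_law[of a x d] ab by auto
  then have "inf (sup a d) x = a"
    using xd by (simp add: inf_commute)
  moreover have "inf (sup a d) b = inf (inf (sup a d) x) b"
    using ab by (metis inf_assoc inf_absorb2 sup_ge2)
  ultimately have "inf (sup a d) b = bot"
    using ab by simp
  moreover have "sup (sup a d) b = y"
    using ab xd by (metis sup_assoc sup_commute)
  ultimately show "is_oplus y (sup a d) b"
    by (auto simp: is_oplus_def)
qed

text \<open>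
  Every step \<open>x \<le> y\<close> of the chain contributes a complement \<open>d\<close> of \<open>x\<close> in \<open>y\<close> to the summand
  of its colour.
\<close>

lemma coloured_chain_imp_oplus:
  fixes c :: "'a::{modular_lattice, sectionally_complemented_lattice}"
  assumes "coloured_chain bot c \<alpha> \<beta>"
  shows "\<exists>a b. \<alpha> = Delta a \<and> \<beta> = Delta b \<and> is_oplus c a b"
proof -
  have complement: "\<exists>d. is_oplus y x d \<and> dim x y = Delta d" if "x \<le> y" for x y :: 'a
  proof -
    obtain d where "is_oplus y x d"
      using section_complement[OF \<open>x \<le> y\<close>] by (auto simp: is_oplus_def)
    moreover from this have "dim x y = Delta d"
      using dim_sup_eq_dim_inf[of x d] by (simp add: is_oplus_def Delta_def)
    ultimately show ?thesis by blast
  qed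
  show ?thesis
    using assms
  proof (induction rule: coloured_chain.induct)
    case start
    show ?case
      by (intro exI[of _ bot]) (simp add: is_oplus_def Delta_def dim_self)
  next
    case (left_step x \<alpha> \<beta> y)
    then obtain a b d where ab: "\<alpha> = Delta a" "\<beta> = Delta b" "is_oplus x a b"
      and d: "is_oplus y x d" "dim x y = Delta d"
      using complement by blast
    have "is_oplus (sup a d) a d" "is_oplus y (sup a d) b"
      using is_oplus_extend[OF ab(3) d(1)] by auto
    then show ?case
      using ab d Delta_oplus by metis
  next
    case (right_step x \<alpha> \<beta> y)
    then obtain a b d where ab: "\<alpha> = Delta a" "\<beta> = Delta b" "is_oplus x b a"
      and d: "is_oplus y x d" "dim x y = Delta d"
      using complement is_oplus_commute by blast
    have "is_oplus (sup b d) b d" "is_oplus y (sup b d) a"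
      using is_oplus_extend[OF ab(3) d(1)] by auto
    then show ?case
      using ab d Delta_oplus is_oplus_commute by metis
  qed
qed

lemma V_measure_imp_lower_subset_range:
  "V_measure \<mu> \<Longrightarrow> lower_subset (range \<mu>)"
  unfolding V_measure_def lower_subset_def alg_le_def by (metis rangeE rangeI)

theorem corollary9p6:
  shows "V_measure (Delta :: 'a::{modular_lattice, sectionally_complemented_lattice} \<Rightarrow> 'a dim_monoid)
    \<and> lower_subset (range (Delta :: 'a \<Rightarrow> 'a dim_monoid))"
proof -
  have "V_measure (Delta :: 'a \<Rightarrow> 'a dim_monoid)"
    unfolding V_measure_def
  proof (intro allI impI)
    fix c :: 'a and \<alpha> \<beta>
    assume "Delta c = \<alpha> + \<beta>"
    then have "coloured_chain bot c \<alpha> \<beta>"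
      unfolding Delta_def by (intro dim_eq_add_imp_coloured_chain) auto
    then show "\<exists>a b. \<alpha> = Delta a \<and> \<beta> = Delta b \<and> is_oplus c a b"
      by (rule coloured_chain_imp_oplus)
  qed
  then show ?thesis
    using V_measure_imp_lower_subset_range by blast
qed

end
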